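(* Let $X$ be a normed space and let $u(t)\in X$, $0\le t\le T$, be the solution of a linear PDE $\partial_tu=\mathcal Au$, $u(0)=u_0$. Let $u_h(t)\in\mathbb{C}^{N_h}$ solve the semidiscrete system $\dot u_h=A_hu_h$, $u_h(0)=u_{0,h}$, let $\mathcal I_h:\mathbb{C}^{N_h}\to X$ be a bounded linear reconstruction operator, and set $\varepsilon_{\mathrm{space}}(t)=\lVert u(t)-\mathcal I_hu_h(t)\rVert_X$. Let $(H,J,R)$ be a lift--recovery realization of the semidiscrete system on $[0,T]$ with error $\varepsilon_{\mathrm{lift}}$, and let $\Psi_0=Ju_{0,h}$. Let $V\in\mathbb{C}^{M\times m}$ have full column rank, with $S=V^\dagger V$, $H_K=V^\dagger HV$, $P_V=VS^{-1}V^\dagger$; let $c:[0,T]\to\mathbb{C}^m$ solve $i\dot c=Gc$ with $G=S^{-1}H_K$ and $Vc(0)=P_V\Psi_0$, and put $\Psi_m(t)=Vc(t)$. Let $\widehat S=S+\Delta S$ (invertible) and $\widehat H_K=H_K+\Delta H$ be $m\times m$ matrices, $\widehat G=\widehat S^{-1}\widehat H_K$, let $\widehat c$ solve $i\dot{\widehat c}=\widehat G\widehat c$ with $\widehat c(0)=c(0)$, and put $\widehat\Psi_m(t)=V\widehat c(t)$. Define $$\varepsilon_{\mathrm{proj}}(t)=\lVert(I-P_V)\Psi_0\rVert_2+\int_0^t\lVert(I-P_V)H\Psi_m(s)\rVert_2\,ds,\qquad \varepsilon_{\mathrm{sample}}(t)=\lVert V\rVert_2\,\lVert\widehat c(t)-c(t)\rVert_2,$$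 and the recovered sampled approximation $\widetilde u_m(t)=\mathcal I_hR\widehat\Psi_m(t)$. Then for $0\le t\le T$, $$\lVert u(t)-\widetilde u_m(t)\rVert_X\le\varepsilon_{\mathrm{space}}(t)+\lVert\mathcal I_h\rVert\Bigl(\varepsilon_{\mathrm{lift}}(t)+\lVert R\rVert_2\bigl(\varepsilon_{\mathrm{proj}}(t)+\varepsilon_{\mathrm{sample}}(t)\bigr)\Bigr).$$
   Context: $\lVert\cdot\rVert_2$ denotes the Euclidean vector norm and the induced spectral matrix norm; $\lVert\mathcal I_h\rVert$ is the operator norm of $\mathcal I_h$ from $(\mathbb{C}^{N_h},\lVert\cdot\rVert_2)$ to $(X,\lVert\cdot\rVert_X)$; $\dagger$ is the conjugate transpose. Lift--recovery realization: given $A_h\in\mathbb{C}^{N_h\times N_h}$, $u_{0,h}\in\mathbb{C}^{N_h}$ and the solution $u_h$ of $\dot u_h=A_hu_h$, $u_h(0)=u_{0,h}$, a lift--recovery realization on $[0,T]$ with error $\varepsilon_{\mathrm{lift}}:[0,T]\to[0,\infty)$ consists of a Hermitian matrix $H\in\mathbb{C}^{M\times M}$, a linear injection $J:\mathbb{C}^{N_h}\to\mathbb{C}^M$ and a linear recovery map $R:\mathbb{C}^M\to\mathbb{C}^{N_h}$ such that $$\lVert u_h(t)-R\,e^{-itH}Ju_{0,h}\rVert_2\le\varepsilon_{\mathrm{lift}}(t)\qquad\text{for all }0\le t\le T .$$ (All these objects may depend on a mesh parameter $h$, an auxiliary resolution parameter $q$, and a parameter vector $\mu$, which are held fixed.)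 *)

theory Defs
  imports "HOL-Analysis.Analysis"
begin

text \<open>
  Complex normed spaces. The law for the multiplication by \<open>1\<close> follows from the compatibility
  with \<open>scaleR\<close>.
\<close>

class complex_normed_vector = real_normed_vector +
  fixes scaleC :: "complex \<Rightarrow> 'a \<Rightarrow> 'a"  (infixr \<open>*\<^sub>C\<close> 75)
  assumes scaleC_add_right: "a *\<^sub>C (x + y) = a *\<^sub>C x + a *\<^sub>C y"
    and scaleC_add_left: "(a + b) *\<^sub>C x = a *\<^sub>C x + b *\<^sub>C x"
    and scaleC_scaleC: "a *\<^sub>C b *\<^sub>C x = (a * b) *\<^sub>C x"
    and scaleC_of_real: "complex_of_real r *\<^sub>C x = r *\<^sub>R x"
    and norm_scaleC: "norm (a *\<^sub>C x) = cmod a * norm x"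

lemma scaleC_one: "1 *\<^sub>C x = (x :: 'a::complex_normed_vector)"
  using scaleC_of_real[of 1 x] by simp

interpretation complex_vector:
  vector_space "scaleC :: complex \<Rightarrow> 'a \<Rightarrow> 'a::complex_normed_vector"
  by unfold_locales (simp_all add: scaleC_add_right scaleC_add_left scaleC_scaleC scaleC_one)

instantiation complex :: complex_normed_vector
begin

definition scaleC_complex :: "complex \<Rightarrow> complex \<Rightarrow> complex"
  where "scaleC_complex a x = a * x"

instance
  by standard (simp_all add: scaleC_complex_def algebra_simps norm_mult scaleR_conv_of_real)

end

text \<open>
  Componentwise multiplication; through the nested instance it also gives the multiplication of
  a complex matrix by a scalar.
\<close>

instantiation vec :: (complex_normed_vector, finite) complex_normed_vector
begin

definition scaleC_vec :: "complex \<Rightarrow> 'a ^ 'b \<Rightarrow> 'a ^ 'b"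
  where "scaleC_vec a x = (\<chi> i. a *\<^sub>C (x $ i))"

instance
proof
  fix a :: complex and x :: "'a ^ 'b"
  show "norm (a *\<^sub>C x) = cmod a * norm x"
    by (simp add: scaleC_vec_def norm_vec_def norm_scaleC L2_set_right_distrib)
qed (simp_all add: scaleC_vec_def vec_eq_iff scaleC_add_right scaleC_add_left scaleC_scaleC
      scaleC_of_real)

end

lemma scaleC_vec_eq: "a *\<^sub>C x = a *s (x :: complex ^ 'n)"
  by (simp add: scaleC_vec_def scaleC_complex_def vec_eq_iff)

abbreviation clinear :: "('a::complex_normed_vector \<Rightarrow> 'b::complex_normed_vector) \<Rightarrow> bool"
  where "clinear \<equiv> Vector_Spaces.linear scaleC scaleC"

definition dagger :: "complex ^ 'n ^ 'm \<Rightarrow> complex ^ 'm ^ 'n"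
  where "dagger A = (\<chi> i j. cnj (A $ j $ i))"

definition hermitian :: "complex ^ 'n ^ 'n \<Rightarrow> bool"
  where "hermitian A \<longleftrightarrow> dagger A = A"

text \<open>The norm induced by the Euclidean vector norms (\<open>norm\<close> on matrices is the Frobenius norm).\<close>

definition spectral_norm :: "complex ^ 'n ^ 'm \<Rightarrow> real"
  where "spectral_norm A = onorm (\<lambda>x. A *v x)"

text \<open>
  The powers have to be formed with \<open>**\<close>: the type class product on \<open>vec\<close>, and hence \<open>^\<close>, is
  componentwise.
\<close>

primrec matrix_power :: "complex ^ 'n ^ 'n \<Rightarrow> nat \<Rightarrow> complex ^ 'n ^ 'n"
  where
    "matrix_power A 0 = mat 1"
  | "matrix_power A (Suc k) = A ** matrix_power A k"

definition matrix_exp :: "complex ^ 'n ^ 'n \<Rightarrow> complex ^ 'n ^ 'n"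
  where "matrix_exp A = (\<Sum>k. (1 / fact k) *\<^sub>R matrix_power A k)"

text \<open>A possibly unbounded linear operator; values outside the domain \<open>D\<close> are irrelevant.\<close>

definition linear_operator_on ::
    "'a set \<Rightarrow> ('a::complex_normed_vector \<Rightarrow> 'a) \<Rightarrow> bool"
  where "linear_operator_on D \<A> \<longleftrightarrow>
    complex_vector.subspace D \<and>
    (\<forall>x\<in>D. \<forall>y\<in>D. \<A> (x + y) = \<A> x + \<A> y) \<and>
    (\<forall>a. \<forall>x\<in>D. \<A> (a *\<^sub>C x) = a *\<^sub>C \<A> x)"

text \<open>
  Classical solutions of \<open>\<partial>\<^sub>t u = \<A> u\<close>, \<open>u(0) = u0\<close> in the sense of semigroup theory: the initial
  value need not lie in \<open>D\<close>, and the equation is required in the interior of the interval.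
\<close>

definition evolution_solution ::
    "real \<Rightarrow> 'a set \<Rightarrow> ('a::complex_normed_vector \<Rightarrow> 'a) \<Rightarrow> 'a \<Rightarrow> (real \<Rightarrow> 'a) \<Rightarrow> bool"
  where "evolution_solution T D \<A> u0 u \<longleftrightarrow>
    continuous_on {0..T} u \<and> u 0 = u0 \<and>
    (\<forall>t\<in>{0<..<T}. u t \<in> D \<and> (u has_vector_derivative \<A> (u t)) (at t))"

definition ode_solution ::
    "real \<Rightarrow> complex ^ 'n ^ 'n \<Rightarrow> complex ^ 'n \<Rightarrow> (real \<Rightarrow> complex ^ 'n) \<Rightarrow> bool"
  where "ode_solution T A y0 y \<longleftrightarrow>
    y 0 = y0 \<and>
    (\<forall>t\<in>{0..T}. (y has_vector_derivative A *v y t) (at t within {0..T}))"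

text \<open>Solutions of \<open>\<i> c' = G c\<close>.\<close>

definition schroedinger_solution ::
    "real \<Rightarrow> complex ^ 'n ^ 'n \<Rightarrow> (real \<Rightarrow> complex ^ 'n) \<Rightarrow> bool"
  where "schroedinger_solution T G c \<longleftrightarrow>
    (\<forall>t\<in>{0..T}. \<exists>c'. (c has_vector_derivative c') (at t within {0..T}) \<and>
       \<i> *\<^sub>C c' = G *v c t)"

text \<open>Here \<open>y\<close> is the solution, with initial value \<open>y0\<close>, of the system that is realized.\<close>

definition lift_recovery_realization ::
    "real \<Rightarrow> complex ^ 'n \<Rightarrow> (real \<Rightarrow> complex ^ 'n) \<Rightarrow> (real \<Rightarrow> real) \<Rightarrow>
     complex ^ 'M ^ 'M \<Rightarrow> (complex ^ 'n \<Rightarrow> complex ^ 'M) \<Rightarrow> (complex ^ 'M \<Rightarrow> complex ^ 'n) \<Rightarrow> bool"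
  where "lift_recovery_realization T y0 y \<epsilon> H J R \<longleftrightarrow>
    hermitian H \<and> clinear J \<and> inj J \<and> clinear R \<and>
    (\<forall>t\<in>{0..T}. 0 \<le> \<epsilon> t) \<and>
    (\<forall>t\<in>{0..T}. norm (y t - R (matrix_exp ((- \<i> * complex_of_real t) *\<^sub>C H) *v J y0)) \<le> \<epsilon> t)"

end

theory Submission
  imports Defs
begin

text \<open>
  With \<open>r = (I - P\<^sub>V) H \<Psi>\<^sub>m\<close>, the error \<open>e(t) = exp(-\<i>tH) \<Psi>\<^sub>0 - \<Psi>\<^sub>m(t)\<close> satisfies
  \<open>e' = -\<i>He - \<i>r\<close>, because \<open>V G c = P\<^sub>V H \<Psi>\<^sub>m\<close>. Since \<open>-\<i>He\<close> is orthogonal to \<open>e\<close> in the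
  real inner product, only \<open>r\<close> makes \<open>\<parallel>e\<parallel>\<close> grow, whence \<open>\<parallel>e(t)\<parallel> \<le> \<epsilon>_proj(t)\<close>. The other
  contributions are added by the triangle inequality.
\<close>

subsection \<open>The matrix exponential\<close>

lemma matrix_power_scaleC: "matrix_power (z *\<^sub>C A) k = (z ^ k) *\<^sub>C matrix_power A k"
proof (induction k)
  case 0
  show ?case by (simp add: scaleC_one)
next
  case (Suc k)
  then show ?case
    by (simp add: vec_eq_iff matrix_matrix_mult_def scaleC_vec_def scaleC_complex_def
        sum_distrib_left mult_ac)
qed

text \<open>Each application of \<open>A\<close> costs at most one factor of the spectral norm, and
  an entry of the power is a coordinate of the image of a unit vector. The geometric bound makes the
  exponential series comparable with a scalar one.\<close>

lemma norm_matrix_power_entry_le: "norm (matrix_power A k $ i $ j) \<le> spectral_norm A ^ k"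
proof -
  have le: "norm (matrix_power A k *v x) \<le> spectral_norm A ^ k * norm x" for x
  proof (induction k)
    case 0
    show ?case by simp
  next
    case (Suc k)
    have "norm (matrix_power A (Suc k) *v x) = norm (A *v (matrix_power A k *v x))"
      by (simp add: matrix_vector_mul_assoc)
    also have "\<dots> \<le> spectral_norm A * norm (matrix_power A k *v x)"
      unfolding spectral_norm_def by (rule onorm) simp
    also have "\<dots> \<le> spectral_norm A * (spectral_norm A ^ k * norm x)"
      using Suc by (intro mult_left_mono) (simp_all add: spectral_norm_def onorm_pos_le)
    finally show ?case by (simp add: mult_ac)
  qed
  have "matrix_power A k $ i $ j = (matrix_power A k *v axis j 1) $ i"
    by (simp add: matrix_vector_mul_component inner_axis matrix_vector_mult_def axis_def if_distrib
        cong: if_cong)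
  then show ?thesis
    using Finite_Cartesian_Product.norm_nth_le[of "matrix_power A k *v axis j 1" i]
      le[of "axis j 1"]
    by simp
qed

lemma summable_matrix_power_entry:
  "summable (\<lambda>k. matrix_power A k $ i $ j / fact k * z ^ k)"
proof (rule summable_comparison_test)
  show "summable (\<lambda>k. inverse (fact k) * (spectral_norm A * cmod z) ^ k)"
    by (rule summable_exp)
  show "\<exists>N. \<forall>k\<ge>N. norm (matrix_power A k $ i $ j / fact k * z ^ k)
      \<le> inverse (fact k) * (spectral_norm A * cmod z) ^ k"
    using mult_right_mono[OF norm_matrix_power_entry_le[of A _ i j], of "cmod z ^ _"]
    by (auto simp: norm_mult norm_divide norm_power power_mult_distrib field_simps)
qed

text \<open>Convergence of matrices is entrywise, so each entry of the exponential becomes a scalar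
  power series in \<open>z\<close>, which can be differentiated term by term.\<close>

lemma matrix_exp_scaleC_entry:
  "matrix_exp (z *\<^sub>C A) $ i $ j = (\<Sum>k. matrix_power A k $ i $ j / fact k * z ^ k)"
proof -
  define E where "E = (\<chi> i j. \<Sum>k. matrix_power A k $ i $ j / fact k * z ^ k)"
  have "(\<lambda>k. (1 / fact k) *\<^sub>R matrix_power (z *\<^sub>C A) k) sums E"
    unfolding sums_def
  proof (intro vec_tendstoI)
    fix i j
    have "(\<lambda>k. matrix_power A k $ i $ j / fact k * z ^ k) sums (E $ i $ j)"
      unfolding E_def using summable_sums[OF summable_matrix_power_entry] by simp
    then show "(\<lambda>n. (\<Sum>k<n. (1 / fact k) *\<^sub>R matrix_power (z *\<^sub>C A) k) $ i $ j)
        \<longlonglongrightarrow> E $ i $ j"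
      by (simp add: sums_def matrix_power_scaleC)
        (simp add: scaleC_vec_def scaleC_complex_def scaleR_conv_of_real[where 'a = complex] mult_ac)
  qed
  then have "matrix_exp (z *\<^sub>C A) = E"
    by (simp add: matrix_exp_def sums_iff)
  then show ?thesis by (simp add: E_def)
qed

lemma matrix_exp_0: "matrix_exp (0 *\<^sub>C A) = mat 1"
proof -
  have "matrix_exp (0 *\<^sub>C A) $ i $ j = mat 1 $ i $ j" for i j
    by (simp only: matrix_exp_scaleC_entry powser_zero) simp
  then show ?thesis by (simp add: vec_eq_iff)
qed

text \<open>Differentiating the series shifts its coefficients: the factor k + 1 cancels against the
  factorial and leaves the entries of \<open>A ** matrix_power A k\<close> over
  \<open>fact k\<close>. The finite sum of the matrix product then commutes with the series.\<close>

lemma has_field_derivative_matrix_exp_entry: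
  "((\<lambda>z. matrix_exp (z *\<^sub>C A) $ i $ j) has_field_derivative (A ** matrix_exp (z *\<^sub>C A)) $ i $ j)
     (at z)"
proof -
  let ?a = "\<lambda>i j k. matrix_power A k $ i $ j / fact k"
  have diffs: "diffs (?a i j) k = (\<Sum>l\<in>UNIV. A $ i $ l * ?a l j k)" for k
  proof -
    have "diffs (?a i j) k = (A ** matrix_power A k) $ i $ j / fact k"
      by (simp add: diffs_def fact_Suc del: of_nat_Suc)
    then show ?thesis
      by (simp add: matrix_matrix_mult_def sum_divide_distrib)
  qed
  have "(\<Sum>k. diffs (?a i j) k * z ^ k) = (\<Sum>k. \<Sum>l\<in>UNIV. A $ i $ l * (?a l j k * z ^ k))"
    by (simp only: diffs sum_distrib_right mult.assoc)
  also have "\<dots> = (\<Sum>l\<in>UNIV. \<Sum>k. A $ i $ l * (?a l j k * z ^ k))"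
    by (rule suminf_sum) (intro summable_mult summable_matrix_power_entry)
  also have "\<dots> = (A ** matrix_exp (z *\<^sub>C A)) $ i $ j"
    unfolding matrix_matrix_mult_def
    by (simp add: matrix_exp_scaleC_entry suminf_mult summable_matrix_power_entry
        del: times_divide_eq_left)
  finally have eq: "(\<Sum>k. diffs (?a i j) k * z ^ k) = (A ** matrix_exp (z *\<^sub>C A)) $ i $ j" .
  show ?thesis
    unfolding matrix_exp_scaleC_entry[of _ A i j] eq[symmetric]
    by (rule termdiffs_strong_converges_everywhere) (rule summable_matrix_power_entry)
qed

lemma has_vector_derivative_vecI:
  fixes f :: "real \<Rightarrow> 'a::real_normed_vector ^ 'n"
  assumes "\<And>i. ((\<lambda>t. f t $ i) has_vector_derivative f' $ i) (at x within S)"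
  shows "(f has_vector_derivative f') (at x within S)"
  using assms unfolding has_vector_derivative_def has_derivative_within
  by (auto intro!: vec_tendstoI bounded_linear_scaleR_left)

text \<open>The chain rule along the real curve \<open>- \<i> * t\<close> in the complex plane,
  applied to each entry of the exponential.\<close>

lemma has_vector_derivative_matrix_exp_mult:
  "((\<lambda>t. matrix_exp ((- \<i> * complex_of_real t) *\<^sub>C H) *v v) has_vector_derivative
     - \<i> *\<^sub>C (H *v (matrix_exp ((- \<i> * complex_of_real t) *\<^sub>C H) *v v))) (at t within X)"
proof (rule has_vector_derivative_vecI)
  fix i
  let ?E = "\<lambda>t. matrix_exp ((- \<i> * complex_of_real t) *\<^sub>C H)"
  have deriv: "((\<lambda>t. ?E t $ i $ j) has_vector_derivative - \<i> * (H ** ?E t) $ i $ j) (at t within X)"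
    for j
  proof -
    have "((\<lambda>t. - \<i> * complex_of_real t) has_vector_derivative - \<i>) (at t within X)"
      by (auto intro!: derivative_eq_intros)
    from field_vector_diff_chain_within[OF this
        has_field_derivative_at_within[OF has_field_derivative_matrix_exp_entry]]
    show ?thesis by (simp add: o_def)
  qed
  have "((\<lambda>t. \<Sum>j\<in>UNIV. ?E t $ i $ j * v $ j) has_vector_derivative
      (\<Sum>j\<in>UNIV. - \<i> * (H ** ?E t) $ i $ j * v $ j)) (at t within X)"
    by (intro has_vector_derivative_sum has_vector_derivative_mult_left deriv)
  moreover have "(\<Sum>j\<in>UNIV. - \<i> * (H ** ?E t) $ i $ j * v $ j) =
      (- \<i> *\<^sub>C (H *v (?E t *v v))) $ i"
    unfolding matrix_vector_mul_assoc
    by (simp add: scaleC_vec_def scaleC_complex_def matrix_vector_mult_def sum_distrib_left mult_ac)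
  ultimately show "((\<lambda>t. (?E t *v v) $ i) has_vector_derivative
      (- \<i> *\<^sub>C (H *v (?E t *v v))) $ i) (at t within X)"
    by (simp add: matrix_vector_mult_def)
qed

subsection \<open>Adjoints\<close>

text \<open>\<open>inner\<close> is the real part of the Hermitian product. Interchanging the two
  sums proves the adjoint identity for the Hermitian product, and \<open>Re\<close> transfers
  it.\<close>

lemma inner_dagger:
  fixes A :: "complex ^ 'n ^ 'm"
  shows "inner (dagger A *v x) y = inner x (A *v y)"
proof -
  have "(\<Sum>i\<in>UNIV. (dagger A *v x) $ i * cnj (y $ i)) =
      (\<Sum>i\<in>UNIV. \<Sum>j\<in>UNIV. cnj (A $ j $ i) * x $ j * cnj (y $ i))"
    by (simp add: dagger_def matrix_vector_mult_def sum_distrib_right)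
  also have "\<dots> = (\<Sum>j\<in>UNIV. \<Sum>i\<in>UNIV. cnj (A $ j $ i) * x $ j * cnj (y $ i))"
    by (rule sum.swap)
  also have "\<dots> = (\<Sum>j\<in>UNIV. x $ j * cnj ((A *v y) $ j))"
    by (simp add: matrix_vector_mult_def sum_distrib_left mult_ac)
  finally have "Re (\<Sum>i\<in>UNIV. (dagger A *v x) $ i * cnj (y $ i)) =
      Re (\<Sum>j\<in>UNIV. x $ j * cnj ((A *v y) $ j))"
    by simp
  then show ?thesis by (simp add: inner_vec_def inner_complex_def)
qed

lemma inner_imaginary_scaleC_right:
  fixes x y :: "complex ^ 'n"
  shows "inner x (\<i> *\<^sub>C y) = - inner (\<i> *\<^sub>C x) y"
  by (simp add: inner_vec_def inner_complex_def scaleC_vec_def scaleC_complex_def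
      flip: sum_negf)

lemma bounded_linear_scaleC_right: "bounded_linear (scaleC a)"
proof (rule bounded_linear_intro)
  show "a *\<^sub>C (r *\<^sub>R x) = r *\<^sub>R (a *\<^sub>C x)" for r x
    by (simp add: scaleC_scaleC mult.commute flip: scaleC_of_real)
  show "norm (a *\<^sub>C x) \<le> norm x * cmod a" for x
    by (simp add: norm_scaleC)
qed (rule scaleC_add_right)

lemma matrix_vector_mult_scaleC:
  fixes A :: "complex ^ 'n ^ 'm"
  shows "A *v (a *\<^sub>C x) = a *\<^sub>C (A *v x)"
  by (simp add: scaleC_vec_eq vec.scale)

text \<open>\<open>H\<close> is self-adjoint, while multiplication by \<i> is skew for the real
  inner product and commutes with \<open>H\<close>; hence the quantity equals its own negative. This
  is the infinitesimal form of norm conservation.\<close>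

lemma hermitian_inner_imaginary:
  assumes "hermitian H"
  shows "inner x (\<i> *\<^sub>C (H *v x)) = 0"
proof -
  have "inner x (\<i> *\<^sub>C (H *v x)) = inner (dagger H *v x) (\<i> *\<^sub>C x)"
    by (simp add: inner_dagger matrix_vector_mult_scaleC)
  also have "\<dots> = - inner x (\<i> *\<^sub>C (H *v x))"
    using assms by (simp add: hermitian_def inner_imaginary_scaleC_right inner_commute)
  finally show ?thesis by simp
qed

subsection \<open>The perturbed Schroedinger equation\<close>

text \<open>
  The function \<open>t \<mapsto> sqrt (\<parallel>e t\<parallel>\<^sup>2 + \<delta>\<^sup>2)\<close> replaces the norm, which is not
  differentiable at zeros of \<open>e\<close>.
\<close>

lemma norm_perturbed_schroedinger_le:
  fixes e r :: "real \<Rightarrow> complex ^ 'n"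
  assumes H: "hermitian H"
    and t: "0 \<le> t"
    and deriv: "\<And>s. s \<in> {0..t} \<Longrightarrow>
      (e has_vector_derivative - \<i> *\<^sub>C (H *v e s) + r s) (at s within {0..t})"
    and r: "continuous_on {0..t} r"
  shows "norm (e t) \<le> norm (e 0) + integral {0..t} (\<lambda>s. norm (r s))"
proof (rule field_le_epsilon)
  fix \<delta> :: real assume \<delta>: "0 < \<delta>"
  define f where "f s = sqrt (inner (e s) (e s) + \<delta>\<^sup>2)" for s
  have pos: "0 < inner (e s) (e s) + \<delta>\<^sup>2" for s
    using \<delta> by (simp add: add_nonneg_pos)
  have f': "(f has_vector_derivative inner (e s) (r s) / f s) (at s within {0..t})"
    if "s \<in> {0..t}" for s
  proof -
    let ?d = "- \<i> *\<^sub>C (H *v e s) + r s"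
    have "((\<lambda>s. inner (e s) (e s)) has_derivative (\<lambda>h. h * (2 * inner (e s) ?d)))
        (at s within {0..t})"
      using deriv[OF that, unfolded has_vector_derivative_def]
      by (auto intro!: derivative_eq_intros simp: inner_commute algebra_simps)
    then have "((\<lambda>s. inner (e s) (e s)) has_real_derivative 2 * inner (e s) ?d)
        (at s within {0..t})"
      by (simp add: has_field_derivative_def mult_commute_abs)
    \<comment> \<open>The Hermitian part of the derivative is orthogonal to \<open>e s\<close>, so
      only the perturbation survives.\<close>
    moreover have "inner (e s) ?d = inner (e s) (r s)"
      by (simp add: inner_diff_right hermitian_inner_imaginary[OF H])
    ultimately have "((\<lambda>s. inner (e s) (e s)) has_real_derivative 2 * inner (e s) (r s))
        (at s within {0..t})"
      by simp
    then have "(f has_real_derivative inner (e s) (r s) / f s) (at s within {0..t})"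
      unfolding f_def using pos[of s]
      by (auto intro!: derivative_eq_intros simp: field_simps)
    then show ?thesis
      by (simp add: has_real_derivative_iff_has_vector_derivative)
  qed
  have norm_le_f: "norm (e s) \<le> f s" for s
    unfolding f_def norm_eq_sqrt_inner by simp
  have "((\<lambda>s. inner (e s) (r s) / f s) has_integral f t - f 0) {0..t}"
    using t f' by (rule fundamental_theorem_of_calculus)
  moreover have "((\<lambda>s. norm (r s)) has_integral integral {0..t} (\<lambda>s. norm (r s))) {0..t}"
    by (intro integrable_integral integrable_continuous_interval continuous_intros r)
  \<comment> \<open>Since \<open>f\<close> dominates the norm of \<open>e\<close>, Cauchy-Schwarz
    bounds the derivative of \<open>f\<close> independently of \<delta>.\<close>
  moreover have "inner (e s) (r s) / f s \<le> norm (r s)" for s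
  proof -
    have "inner (e s) (r s) \<le> norm (e s) * norm (r s)"
      by (rule norm_cauchy_schwarz)
    also have "\<dots> \<le> f s * norm (r s)"
      by (rule mult_right_mono[OF norm_le_f]) simp
    finally show ?thesis
      using pos[of s] by (simp add: f_def field_simps)
  qed
  ultimately have "f t - f 0 \<le> integral {0..t} (\<lambda>s. norm (r s))"
    by (rule has_integral_le)
  \<comment> \<open>Subadditivity of the square root: the regularization costs at most \<delta>,
    which is arbitrary.\<close>
  moreover have "f 0 \<le> norm (e 0) + \<delta>"
    using sqrt_add_le_add_sqrt[of "inner (e 0) (e 0)" "\<delta>\<^sup>2"] \<delta>
    by (simp add: f_def norm_eq_sqrt_inner)
  ultimately show "norm (e t) \<le> norm (e 0) + integral {0..t} (\<lambda>s. norm (r s)) + \<delta>"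
    using norm_le_f[of t] by simp
qed

section \<open>Splitting of the total error into its four contributions\<close>

theorem corollary2:
  fixes T :: real
    and D :: "'x::complex_normed_vector set" and \<A> :: "'x \<Rightarrow> 'x"
    and u0 :: 'x and u :: "real \<Rightarrow> 'x"
    and A\<^sub>h :: "complex ^ 'n ^ 'n" and u0\<^sub>h :: "complex ^ 'n" and u\<^sub>h :: "real \<Rightarrow> complex ^ 'n"
    and \<I>\<^sub>h :: "complex ^ 'n \<Rightarrow> 'x"
    and H :: "complex ^ 'M ^ 'M"
    and J :: "complex ^ 'n \<Rightarrow> complex ^ 'M" and R :: "complex ^ 'M \<Rightarrow> complex ^ 'n"
    and \<Psi>\<^sub>0 :: "complex ^ 'M"
    and V :: "complex ^ 'm ^ 'M" and P\<^sub>V :: "complex ^ 'M ^ 'M"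
    and S H\<^sub>K G \<Delta>S \<Delta>H S' H\<^sub>K' G' :: "complex ^ 'm ^ 'm"
    and c c' :: "real \<Rightarrow> complex ^ 'm" and \<Psi>\<^sub>m \<Psi>\<^sub>m' :: "real \<Rightarrow> complex ^ 'M"
    and \<epsilon>_space \<epsilon>_lift \<epsilon>_proj \<epsilon>_sample :: "real \<Rightarrow> real"
    and u\<^sub>m' :: "real \<Rightarrow> 'x"
  assumes "0 \<le> T"
    and "linear_operator_on D \<A>"
    and "evolution_solution T D \<A> u0 u"
    and "ode_solution T A\<^sub>h u0\<^sub>h u\<^sub>h"
    and "clinear \<I>\<^sub>h" and "bounded_linear \<I>\<^sub>h"
    and "\<And>t. \<epsilon>_space t = norm (u t - \<I>\<^sub>h (u\<^sub>h t))"
    and "lift_recovery_realization T u0\<^sub>h u\<^sub>h \<epsilon>_lift H J R"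
    and "\<Psi>\<^sub>0 = J u0\<^sub>h"
    and "rank V = CARD('m)"
    and "S = dagger V ** V"
    and "H\<^sub>K = dagger V ** H ** V"
    and "P\<^sub>V = V ** matrix_inv S ** dagger V"
    and "G = matrix_inv S ** H\<^sub>K"
    and "schroedinger_solution T G c"
    and "V *v c 0 = P\<^sub>V *v \<Psi>\<^sub>0"
    and "\<And>t. \<Psi>\<^sub>m t = V *v c t"
    and "S' = S + \<Delta>S" and "invertible S'"
    and "H\<^sub>K' = H\<^sub>K + \<Delta>H"
    and "G' = matrix_inv S' ** H\<^sub>K'"
    and "schroedinger_solution T G' c'"
    and "c' 0 = c 0"
    and "\<And>t. \<Psi>\<^sub>m' t = V *v c' t"
    and "\<And>t. \<epsilon>_proj t = norm ((mat 1 - P\<^sub>V) *v \<Psi>\<^sub>0)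
               + integral {0..t} (\<lambda>s. norm ((mat 1 - P\<^sub>V) *v (H *v \<Psi>\<^sub>m s)))"
    and "\<And>t. \<epsilon>_sample t = spectral_norm V * norm (c' t - c t)"
    and "\<And>t. u\<^sub>m' t = \<I>\<^sub>h (R (\<Psi>\<^sub>m' t))"
  shows "\<forall>t\<in>{0..T}. norm (u t - u\<^sub>m' t)
           \<le> \<epsilon>_space t + onorm \<I>\<^sub>h * (\<epsilon>_lift t + onorm R * (\<epsilon>_proj t + \<epsilon>_sample t))"
proof
  fix t assume t: "t \<in> {0..T}"
  \<comment> \<open>The exact lifted evolution, and the residual of the projected one. The factor
    \<open>- \<i>\<close> in \<open>r\<close> has modulus 1, so the norm of \<open>r\<close> is the
    integrand of \<open>\<epsilon>_proj\<close>.\<close>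
  define \<phi> where "\<phi> s = matrix_exp ((- \<i> * complex_of_real s) *\<^sub>C H) *v \<Psi>\<^sub>0" for s
  define r where "r s = - \<i> *\<^sub>C ((mat 1 - P\<^sub>V) *v (H *v \<Psi>\<^sub>m s))" for s
  note lift = assms(8)[unfolded lift_recovery_realization_def]
  have \<Psi>\<^sub>m: "\<Psi>\<^sub>m = (\<lambda>s. V *v c s)"
    using assms(17) by blast
  have c: "(c has_vector_derivative - \<i> *\<^sub>C (G *v c s)) (at s within {0..T})"
    if s: "s \<in> {0..T}" for s
  proof -
    obtain d where d: "(c has_vector_derivative d) (at s within {0..T})"
      and "\<i> *\<^sub>C d = G *v c s"
      using assms(15) s unfolding schroedinger_solution_def by blast
    then have "- \<i> *\<^sub>C (G *v c s) = (- \<i> * \<i>) *\<^sub>C d"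
      by (simp only: scaleC_scaleC[symmetric])
    then have "- \<i> *\<^sub>C (G *v c s) = d"
      by (simp add: scaleC_one)
    with d show ?thesis by simp
  qed
  have \<Psi>\<^sub>m': "(\<Psi>\<^sub>m has_vector_derivative - \<i> *\<^sub>C (P\<^sub>V *v (H *v \<Psi>\<^sub>m s))) (at s within {0..T})"
    if "s \<in> {0..T}" for s
  proof -
    \<comment> \<open>Unfolding \<open>G\<close> gives \<open>V ** G = P\<^sub>V ** H ** V\<close>,
      so the reduced dynamics is the projected Schroedinger equation.\<close>
    have "V *v (- \<i> *\<^sub>C (G *v c s)) = - \<i> *\<^sub>C (P\<^sub>V *v (H *v \<Psi>\<^sub>m s))"
      unfolding matrix_vector_mult_scaleC \<Psi>\<^sub>m
      by (simp add: assms(12-14) matrix_vector_mul_assoc matrix_mul_assoc)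
    with bounded_linear.has_vector_derivative[OF matrix_vector_mul_bounded_linear c[OF that], of V]
    show ?thesis by (simp add: \<Psi>\<^sub>m)
  qed
  have sub: "{0..t} \<subseteq> {0..T}"
    using t by auto
  have "continuous_on {0..T} \<Psi>\<^sub>m"
    using \<Psi>\<^sub>m' by (meson continuous_on_eq_continuous_within has_vector_derivative_continuous)
  then have "continuous_on {0..t} \<Psi>\<^sub>m"
    using sub by (rule continuous_on_subset)
  then have r_cont: "continuous_on {0..t} r"
    unfolding r_def
    by (intro bounded_linear.continuous_on[OF bounded_linear_scaleC_right]
        bounded_linear.continuous_on[OF matrix_vector_mul_bounded_linear])
  have "norm (\<phi> t - \<Psi>\<^sub>m t) \<le> norm (\<phi> 0 - \<Psi>\<^sub>m 0) + integral {0..t} (\<lambda>s. norm (r s))"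
  proof (rule norm_perturbed_schroedinger_le[OF _ _ _ r_cont])
    show "hermitian H" using lift by blast
    show "0 \<le> t" using t by simp
    fix s assume s: "s \<in> {0..t}"
    have "((\<lambda>s. \<phi> s - \<Psi>\<^sub>m s) has_vector_derivative
        - \<i> *\<^sub>C (H *v \<phi> s) - - \<i> *\<^sub>C (P\<^sub>V *v (H *v \<Psi>\<^sub>m s))) (at s within {0..t})"
      unfolding \<phi>_def using s sub
      by (intro has_vector_derivative_diff has_vector_derivative_matrix_exp_mult
          has_vector_derivative_within_subset[OF \<Psi>\<^sub>m' sub]) blast
    \<comment> \<open>Adding and subtracting \<open>H *v \<Psi>\<^sub>m s\<close> isolates the part
      of it removed by the projection.\<close>
    moreover have "- \<i> *\<^sub>C (H *v \<phi> s) - - \<i> *\<^sub>C (P\<^sub>V *v (H *v \<Psi>\<^sub>m s)) =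
        - \<i> *\<^sub>C (H *v (\<phi> s - \<Psi>\<^sub>m s)) + r s"
      by (simp add: r_def matrix_vector_mult_diff_distrib matrix_vector_mult_diff_rdistrib
          complex_vector.scale_right_diff_distrib)
    ultimately show "((\<lambda>s. \<phi> s - \<Psi>\<^sub>m s) has_vector_derivative
        - \<i> *\<^sub>C (H *v (\<phi> s - \<Psi>\<^sub>m s)) + r s) (at s within {0..t})"
      by simp
  qed
  \<comment> \<open>The exponential is the identity at time 0, and the reduced state starts at the
    projection of \<open>\<Psi>\<^sub>0\<close>.\<close>
  moreover have "\<phi> 0 - \<Psi>\<^sub>m 0 = (mat 1 - P\<^sub>V) *v \<Psi>\<^sub>0"
    using matrix_exp_0[of H] assms(16)
    by (simp add: \<phi>_def \<Psi>\<^sub>m matrix_vector_mult_diff_rdistrib)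
  ultimately have proj: "norm (\<phi> t - \<Psi>\<^sub>m t) \<le> \<epsilon>_proj t"
    by (simp add: assms(25) r_def norm_scaleC)
  have sample: "norm (\<Psi>\<^sub>m t - \<Psi>\<^sub>m' t) \<le> \<epsilon>_sample t"
    using onorm[OF matrix_vector_mul_bounded_linear, of V "c t - c' t"]
    by (simp add: assms(24,26) \<Psi>\<^sub>m spectral_norm_def matrix_vector_mult_diff_distrib
        norm_minus_commute)
  \<comment> \<open>Complex linearity restricts to real linearity, and finite dimension then gives
    boundedness, so that \<open>onorm R\<close> yields an estimate.\<close>
  have "clinear R"
    using lift by blast
  then interpret R: Vector_Spaces.linear scaleC scaleC R .
  have "linear R"
    by (rule linearI) (simp_all only: R.add R.scale flip: scaleC_of_real)
  then have R: "bounded_linear R"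
    by (simp only: linear_conv_bounded_linear)
  \<comment> \<open>The intermediate point is the recovered exact evolution
    \<open>R (\<phi> t)\<close>: lift error on one side, projection and sampling errors on the
    other.\<close>
  have "norm (u\<^sub>h t - R (\<Psi>\<^sub>m' t)) \<le> norm (u\<^sub>h t - R (\<phi> t)) + norm (R (\<phi> t - \<Psi>\<^sub>m' t))"
    using norm_triangle_ineq[of "u\<^sub>h t - R (\<phi> t)" "R (\<phi> t) - R (\<Psi>\<^sub>m' t)"]
    by (simp add: linear_diff[OF bounded_linear.linear[OF R]])
  also have "norm (u\<^sub>h t - R (\<phi> t)) \<le> \<epsilon>_lift t"
    using lift t by (simp add: \<phi>_def assms(9))
  also have "norm (R (\<phi> t - \<Psi>\<^sub>m' t)) \<le> onorm R * norm (\<phi> t - \<Psi>\<^sub>m' t)"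
    by (rule onorm[OF R])
  also have "norm (\<phi> t - \<Psi>\<^sub>m' t) \<le> \<epsilon>_proj t + \<epsilon>_sample t"
    using norm_triangle_ineq[of "\<phi> t - \<Psi>\<^sub>m t" "\<Psi>\<^sub>m t - \<Psi>\<^sub>m' t"] proj sample by simp
  finally have recovered: "norm (u\<^sub>h t - R (\<Psi>\<^sub>m' t)) \<le> \<epsilon>_lift t + onorm R * (\<epsilon>_proj t + \<epsilon>_sample t)"
    using onorm_pos_le[OF R] by (simp add: mult_left_mono)
  \<comment> \<open>Here the intermediate point is the reconstructed semidiscrete solution
    \<open>\<I>\<^sub>h (u\<^sub>h t)\<close>.\<close>
  have "norm (u t - u\<^sub>m' t) \<le> \<epsilon>_space t + norm (\<I>\<^sub>h (u\<^sub>h t - R (\<Psi>\<^sub>m' t)))"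
    using norm_triangle_ineq[of "u t - \<I>\<^sub>h (u\<^sub>h t)" "\<I>\<^sub>h (u\<^sub>h t) - \<I>\<^sub>h (R (\<Psi>\<^sub>m' t))"]
    by (simp add: assms(7,27) linear_diff[OF bounded_linear.linear[OF assms(6)]])
  also have "norm (\<I>\<^sub>h (u\<^sub>h t - R (\<Psi>\<^sub>m' t))) \<le> onorm \<I>\<^sub>h * norm (u\<^sub>h t - R (\<Psi>\<^sub>m' t))"
    by (rule onorm[OF assms(6)])
  also have "\<dots> \<le> onorm \<I>\<^sub>h * (\<epsilon>_lift t + onorm R * (\<epsilon>_proj t + \<epsilon>_sample t))"
    by (rule mult_left_mono[OF recovered onorm_pos_le[OF assms(6)]])
  finally show "norm (u t - u\<^sub>m' t)
      \<le> \<epsilon>_space t + onorm \<I>\<^sub>h * (\<epsilon>_lift t + onorm R * (\<epsilon>_proj t + \<epsilon>_sample t))"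
    by simp
qed

end
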